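(* Let $\Gamma_A=(A,\alpha)$ and $\Gamma_B=(B,\beta)$ be two non-negative games, and let $i\in A$. If $\alpha(\{i\})=0$ and $\beta(\{l\})=0$ for all $l\in B$, then the map $$(-\otimes_i-):I(\Gamma_A)\times I(\Gamma_B)\longrightarrow I(\Gamma_A\circ_i\Gamma_B)$$ given by the partial tensor product is surjective.
   Context: A game is a pair $\Gamma=(N,v)$, $N$ a nonempty finite totally ordered set of players, $v:\mathcal P(N)\to\mathbb R$ with $v(\emptyset)=0$; it is non-negative if $v(S)\ge0$ for all $S\subseteq N$. Its set of imputations is $I(\Gamma)=\{x\in\mathbb R^N:\sum_{j\in N}x_j=v(N),\ x_j\ge v(\{j\})\ \forall j\in N\}$. For games $(A,\alpha)$, $(B,\beta)$ with disjoint player sets and $i\in A$, the game $(A,\alpha)\circ_i(B,\beta)$ has player set $A\diamond_iB=(A\setminus\{i\})\cup B$ and coalition function $$(\alpha\circ_i\beta)(S)=\beta(B)\alpha(S\cap A)+\partial_i\alpha(S\cap A)\,\beta(S\cap B),\qquad \partial_i\alpha(T)=\alpha(T\cup\{i\})-\alpha(T\setminus\{i\}).$$ The partial tensor product of $x\in\mathbb R^A$ and $y\in\mathbb R^B$ is the vector $x\otimes_iy\in\mathbb R^{A\diamond_iB}$ with $(x\otimes_iy)_j=\big(\sum_{l\in B}y_l\big)x_j$ for $j\in A\setminus\{i\}$ and $(x\otimes_iy)_j=x_iy_j$ for $j\in B$. It maps pairs of imputations of non-negative games to imputations of the composite.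
   Formalization: The formal theorem adds the assumption that I(Γ_A) is nonempty whenever β(B)=0; without it the claim fails, e.g. A={i,a}, α({a})=1 and α=0 otherwise, B={b}, β=0, where I(Γ_A) is empty but the composite has the zero imputation. *)

theory Defs
  imports Complex_Main "HOL-Library.FuncSet"
begin

text \<open>
  A game is a pair of a player set \<open>N\<close> and a coalition function \<open>v\<close>, of which only the values on
  subsets of \<open>N\<close> matter. The total order on the players is omitted: every finite set carries one,
  and neither coalition functions nor imputations depend on it.
\<close>

definition game :: "'a set \<Rightarrow> ('a set \<Rightarrow> real) \<Rightarrow> bool" where
  "game N v \<longleftrightarrow> finite N \<and> N \<noteq> {} \<and> v {} = 0"

definition nonneg_game :: "'a set \<Rightarrow> ('a set \<Rightarrow> real) \<Rightarrow> bool" where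
  "nonneg_game N v \<longleftrightarrow> game N v \<and> (\<forall>S\<subseteq>N. v S \<ge> 0)"

text \<open>Vectors indexed by \<open>N\<close> are functions that are \<open>undefined\<close> outside \<open>N\<close>.\<close>

definition imputations :: "'a set \<Rightarrow> ('a set \<Rightarrow> real) \<Rightarrow> ('a \<Rightarrow> real) set" where
  "imputations N v = {x \<in> N \<rightarrow>\<^sub>E UNIV. (\<Sum>j\<in>N. x j) = v N \<and> (\<forall>j\<in>N. x j \<ge> v {j})}"

definition marginal :: "'a \<Rightarrow> ('a set \<Rightarrow> real) \<Rightarrow> 'a set \<Rightarrow> real" where
  "marginal i \<alpha> T = \<alpha> (T \<union> {i}) - \<alpha> (T - {i})"

definition comp_players :: "'a set \<Rightarrow> 'a \<Rightarrow> 'a set \<Rightarrow> 'a set" where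
  "comp_players A i B = (A - {i}) \<union> B"

definition comp_value ::
  "'a set \<Rightarrow> ('a set \<Rightarrow> real) \<Rightarrow> 'a \<Rightarrow> 'a set \<Rightarrow> ('a set \<Rightarrow> real) \<Rightarrow> 'a set \<Rightarrow> real" where
  "comp_value A \<alpha> i B \<beta> S = \<beta> B * \<alpha> (S \<inter> A) + marginal i \<alpha> (S \<inter> A) * \<beta> (S \<inter> B)"

definition partial_tensor ::
  "'a set \<Rightarrow> 'a \<Rightarrow> 'a set \<Rightarrow> ('a \<Rightarrow> real) \<Rightarrow> ('a \<Rightarrow> real) \<Rightarrow> 'a \<Rightarrow> real" where
  "partial_tensor A i B x y =
     (\<lambda>j\<in>comp_players A i B. if j \<in> B then x i * y j else (\<Sum>l\<in>B. y l) * x j)"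

text \<open>
  If \<open>\<beta> B = 0\<close>, the composite of two non-negative games with \<open>\<alpha> {i} = 0\<close> and all \<open>\<beta> {l} = 0\<close>
  has exactly one imputation, the zero vector, even when \<open>\<alpha>\<close> has none (for example
  \<open>A = {i, a}\<close>, \<open>\<alpha> {a} = 1\<close>, \<open>\<alpha> {i} = \<alpha> A = 0\<close>). The partial tensor product is then not
  surjective, so surjectivity requires that \<open>\<beta> B = 0\<close> implies \<open>imputations A \<alpha> \<noteq> {}\<close>.
\<close>

end

theory Submission
  imports Defs
begin

text \<open>
  Write \<open>b = \<beta> B\<close>. Since \<open>\<alpha> {i} = 0\<close>, the composite game gives \<open>0\<close> to every single player
  of \<open>B\<close>, it gives \<open>b * \<alpha> {j}\<close> to a player \<open>j\<close> of \<open>A - {i}\<close>, and \<open>b * \<alpha> A\<close> to the grand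
  coalition (\<open>imputations_comp_iff\<close>). So an imputation \<open>z\<close> of the composite carries a non-negative
  amount \<open>s\<close> on \<open>B\<close>, and \<open>B\<close> can be collapsed to the single player \<open>i\<close>: dividing by \<open>b > 0\<close>,
  the vector \<open>x\<close> with \<open>x i = s / b\<close> and \<open>x j = z j / b\<close> elsewhere is an imputation of \<open>\<alpha>\<close>.
  The second factor has to distribute the total \<open>b\<close> over \<open>B\<close> in the same proportions in which
  \<open>z\<close> distributes \<open>s\<close>; if \<open>s = 0\<close>, then \<open>z\<close> vanishes on \<open>B\<close> and any distribution of \<open>b\<close> will do
  (\<open>exists_proportional_distribution\<close>). The condition \<open>\<beta> {l} = 0\<close> is what makes every
  non-negative distribution of \<open>b\<close> an imputation of \<open>\<beta>\<close>.

  If \<open>b = 0\<close>, the only imputation of the composite is the zero vector, and the tensor product of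
  any imputation of \<open>\<alpha>\<close> with the zero imputation of \<open>\<beta>\<close> hits it.
\<close>

text \<open>
  The rescaling \<open>y = b * z / s\<close>, where \<open>s\<close> is the total of \<open>z\<close>, is stated without division, as
  \<open>s * y l = b * z l\<close>, so that the degenerate case \<open>s = 0\<close> is covered by the uniform distribution.
\<close>

lemma exists_proportional_distribution:
  fixes z :: "'a \<Rightarrow> real" and b :: real
  assumes "finite B" and "B \<noteq> {}" and "b \<ge> 0" and "\<And>l. l \<in> B \<Longrightarrow> z l \<ge> 0"
  obtains y where "y \<in> B \<rightarrow>\<^sub>E UNIV" and "(\<Sum>l\<in>B. y l) = b" and "\<And>l. l \<in> B \<Longrightarrow> y l \<ge> 0"
    and "\<And>l. l \<in> B \<Longrightarrow> sum z B * y l = b * z l"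
proof (cases "sum z B = 0")
  case True
  with assms have "\<And>l. l \<in> B \<Longrightarrow> z l = 0"
    by (simp add: sum_nonneg_eq_0_iff)
  then show thesis
    using True assms by (intro that[of "\<lambda>l\<in>B. b / card B"]) auto
next
  case False
  have "(\<Sum>l\<in>B. b * z l / sum z B) = b"
    using False by (simp flip: sum_divide_distrib sum_distrib_left)
  then show thesis
    using False assms
    by (intro that[of "\<lambda>l\<in>B. b * z l / sum z B"]) (auto simp: sum_nonneg)
qed

lemma sum_comp_players:
  assumes "finite A" and "finite B" and "A \<inter> B = {}"
  shows "(\<Sum>j\<in>comp_players A i B. f j) = (\<Sum>j\<in>A - {i}. f j) + (\<Sum>l\<in>B. f l)"
  unfolding comp_players_def using assms by (intro sum.union_disjoint) auto

lemma comp_value_grand_coalition: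
  assumes "A \<inter> B = {}" and "i \<in> A"
  shows "comp_value A \<alpha> i B \<beta> (comp_players A i B) = \<beta> B * \<alpha> A"
proof -
  have "comp_players A i B \<inter> A = A - {i}" and "comp_players A i B \<inter> B = B"
    and "A - {i} \<union> {i} = A"
    using assms by (auto simp: comp_players_def)
  then show ?thesis
    by (simp add: comp_value_def marginal_def insert_absorb[OF assms(2)] algebra_simps)
qed

lemma comp_value_outer_player:
  assumes "A \<inter> B = {}" and "j \<in> A" and "\<beta> {} = 0"
  shows "comp_value A \<alpha> i B \<beta> {j} = \<beta> B * \<alpha> {j}"
proof -
  have "{j} \<inter> A = {j}" and "{j} \<inter> B = {}"
    using assms by auto
  then show ?thesis
    using assms by (simp add: comp_value_def)
qed

lemma comp_value_inner_player:
  assumes "A \<inter> B = {}" and "l \<in> B" and "\<alpha> {} = 0"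
  shows "comp_value A \<alpha> i B \<beta> {l} = \<alpha> {i} * \<beta> {l}"
proof -
  have "{l} \<inter> A = {}" and "{l} \<inter> B = {l}"
    using assms by auto
  then show ?thesis
    using assms by (simp add: comp_value_def marginal_def)
qed

text \<open>
  The bounds on the players of \<open>B\<close> become \<open>0\<close> because \<open>\<beta> {l}\<close> enters the composite only with
  the factor \<open>\<alpha> {i}\<close>.
\<close>

lemma imputations_comp_iff:
  assumes "game A \<alpha>" and "game B \<beta>" and "A \<inter> B = {}" and "i \<in> A" and "\<alpha> {i} = 0"
  shows "z \<in> imputations (comp_players A i B) (comp_value A \<alpha> i B \<beta>) \<longleftrightarrow>
    z \<in> comp_players A i B \<rightarrow>\<^sub>E UNIV \<and>
    (\<Sum>j\<in>A - {i}. z j) + (\<Sum>l\<in>B. z l) = \<beta> B * \<alpha> A \<and>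
    (\<forall>j\<in>A - {i}. z j \<ge> \<beta> B * \<alpha> {j}) \<and> (\<forall>l\<in>B. z l \<ge> 0)"
proof -
  have "comp_value A \<alpha> i B \<beta> {j} = \<beta> B * \<alpha> {j}" if "j \<in> A - {i}" for j
    using comp_value_outer_player[of A B j \<beta>] that assms by (simp add: game_def)
  moreover have "comp_value A \<alpha> i B \<beta> {l} = 0" if "l \<in> B" for l
    using comp_value_inner_player[of A B l \<alpha>] that assms by (simp add: game_def)
  ultimately have "(\<forall>j\<in>comp_players A i B. z j \<ge> comp_value A \<alpha> i B \<beta> {j}) \<longleftrightarrow>
      (\<forall>j\<in>A - {i}. z j \<ge> \<beta> B * \<alpha> {j}) \<and> (\<forall>l\<in>B. z l \<ge> 0)"
    unfolding comp_players_def ball_Un by simp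
  then show ?thesis
    using assms
    by (simp add: imputations_def comp_value_grand_coalition sum_comp_players game_def)
qed

lemma partial_tensor_eqI:
  assumes "z \<in> comp_players A i B \<rightarrow>\<^sub>E UNIV"
    and "\<And>j. j \<in> A - {i} \<Longrightarrow> j \<notin> B \<Longrightarrow> (\<Sum>l\<in>B. y l) * x j = z j"
    and "\<And>l. l \<in> B \<Longrightarrow> x i * y l = z l"
  shows "partial_tensor A i B x y = z"
proof (rule PiE_ext[OF _ assms(1)])
  show "partial_tensor A i B x y \<in> comp_players A i B \<rightarrow>\<^sub>E UNIV"
    by (simp add: partial_tensor_def)
  show "partial_tensor A i B x y j = z j" if "j \<in> comp_players A i B" for j
    using that assms(2,3) by (auto simp: partial_tensor_def comp_players_def)
qed

lemma partial_tensor_in_imputations: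
  assumes "game A \<alpha>" and "nonneg_game B \<beta>" and "A \<inter> B = {}" and "i \<in> A"
    and "\<alpha> {i} = 0" and "\<forall>l\<in>B. \<beta> {l} = 0"
    and x: "x \<in> imputations A \<alpha>" and y: "y \<in> imputations B \<beta>"
  shows "partial_tensor A i B x y \<in> imputations (comp_players A i B) (comp_value A \<alpha> i B \<beta>)"
proof -
  let ?z = "partial_tensor A i B x y"
  have "game B \<beta>" and b: "\<beta> B \<ge> 0" and "finite A"
    using assms by (auto simp: nonneg_game_def game_def)
  have ysum: "(\<Sum>l\<in>B. y l) = \<beta> B"
    using y by (simp add: imputations_def)
  have outer: "?z j = \<beta> B * x j" if "j \<in> A - {i}" for j
    using that \<open>A \<inter> B = {}\<close> by (auto simp: partial_tensor_def comp_players_def ysum)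
  have inner: "?z l = x i * y l" if "l \<in> B" for l
    using that by (simp add: partial_tensor_def comp_players_def)
  have "(\<Sum>j\<in>A - {i}. ?z j) + (\<Sum>l\<in>B. ?z l) = \<beta> B * (\<Sum>j\<in>A - {i}. x j) + x i * \<beta> B"
    by (simp add: outer inner ysum flip: sum_distrib_left)
  also have "\<dots> = \<beta> B * (\<Sum>j\<in>A. x j)"
    using \<open>finite A\<close> \<open>i \<in> A\<close> by (simp add: sum.remove[of A i x] algebra_simps)
  finally have "(\<Sum>j\<in>A - {i}. ?z j) + (\<Sum>l\<in>B. ?z l) = \<beta> B * \<alpha> A"
    using x by (simp add: imputations_def)
  moreover have "\<forall>j\<in>A - {i}. ?z j \<ge> \<beta> B * \<alpha> {j}"
    using x b by (auto simp: outer imputations_def intro: mult_left_mono)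
  moreover have "\<forall>l\<in>B. ?z l \<ge> 0"
  proof
    fix l assume "l \<in> B"
    moreover have "x i \<ge> 0"
      using x \<open>i \<in> A\<close> \<open>\<alpha> {i} = 0\<close> by (force simp: imputations_def)
    moreover have "y l \<ge> 0"
      using y \<open>l \<in> B\<close> \<open>\<forall>l\<in>B. \<beta> {l} = 0\<close> by (force simp: imputations_def)
    ultimately show "?z l \<ge> 0"
      by (simp add: inner)
  qed
  moreover have "?z \<in> comp_players A i B \<rightarrow>\<^sub>E UNIV"
    by (simp add: partial_tensor_def)
  ultimately show ?thesis
    using imputations_comp_iff[OF \<open>game A \<alpha>\<close> \<open>game B \<beta>\<close>] assms by blast
qed

theorem proposition16:
  fixes A B :: "'a set" and \<alpha> \<beta> :: "'a set \<Rightarrow> real" and i :: 'a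
  assumes "nonneg_game A \<alpha>" and "nonneg_game B \<beta>"
    and "A \<inter> B = {}" and "i \<in> A"
    and "\<alpha> {i} = 0" and "\<forall>l\<in>B. \<beta> {l} = 0"
    and "\<beta> B = 0 \<Longrightarrow> imputations A \<alpha> \<noteq> {}"
  shows "(\<lambda>(x, y). partial_tensor A i B x y) ` (imputations A \<alpha> \<times> imputations B \<beta>)
       = imputations (comp_players A i B) (comp_value A \<alpha> i B \<beta>)"
proof -
  have games: "game A \<alpha>" "game B \<beta>"
    using assms by (auto simp: nonneg_game_def)
  show ?thesis
  proof (intro equalityI subsetI)
    fix z assume "z \<in> (\<lambda>(x, y). partial_tensor A i B x y) ` (imputations A \<alpha> \<times> imputations B \<beta>)"
    then show "z \<in> imputations (comp_players A i B) (comp_value A \<alpha> i B \<beta>)"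
      using partial_tensor_in_imputations[OF games(1) assms(2-6)] by auto
  next
    fix z assume z_imp: "z \<in> imputations (comp_players A i B) (comp_value A \<alpha> i B \<beta>)"
    have fin: "finite A" "finite B" "B \<noteq> {}"
      using games by (auto simp: game_def)
    have b: "\<beta> B \<ge> 0"
      using assms by (simp add: nonneg_game_def)
    have z_ext: "z \<in> comp_players A i B \<rightarrow>\<^sub>E UNIV"
      and z_sum: "(\<Sum>j\<in>A - {i}. z j) + (\<Sum>l\<in>B. z l) = \<beta> B * \<alpha> A"
      and z_outer: "\<And>j. j \<in> A - {i} \<Longrightarrow> z j \<ge> \<beta> B * \<alpha> {j}"
      and z_inner: "\<And>l. l \<in> B \<Longrightarrow> z l \<ge> 0"
      using z_imp imputations_comp_iff[OF games assms(3-5)] by blast+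
    obtain y where y_ext: "y \<in> B \<rightarrow>\<^sub>E UNIV" and y_sum: "(\<Sum>l\<in>B. y l) = \<beta> B"
      and y_nonneg: "\<And>l. l \<in> B \<Longrightarrow> y l \<ge> 0"
      and y_prop: "\<And>l. l \<in> B \<Longrightarrow> sum z B * y l = \<beta> B * z l"
      using exists_proportional_distribution[of B "\<beta> B" z] fin b z_inner by metis
    have y: "y \<in> imputations B \<beta>"
      using y_ext y_sum y_nonneg assms(6) by (simp add: imputations_def)
    have "\<exists>x\<in>imputations A \<alpha>. partial_tensor A i B x y = z"
    proof (cases "\<beta> B = 0")
      case True
      then obtain x where x: "x \<in> imputations A \<alpha>"
        using assms(7) by blast
      \<comment> \<open>All bounds in the composite are \<open>0\<close> and so is the total, which forces \<open>z = 0\<close>.\<close>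
      have z_outer0: "\<And>j. j \<in> A - {i} \<Longrightarrow> z j \<ge> 0"
        using z_outer True by force
      then have "(\<Sum>j\<in>A - {i}. z j) \<ge> 0" and "(\<Sum>l\<in>B. z l) \<ge> 0"
        using z_inner by (auto intro: sum_nonneg)
      then have "(\<Sum>j\<in>A - {i}. z j) = 0" and "(\<Sum>l\<in>B. z l) = 0"
        using z_sum True by auto
      then have "\<And>j. j \<in> A - {i} \<Longrightarrow> z j = 0" and "\<And>l. l \<in> B \<Longrightarrow> z l = 0"
        using sum_nonneg_eq_0_iff[of "A - {i}" z] sum_nonneg_eq_0_iff[of B z]
          fin z_inner z_outer0 by blast+
      moreover have "\<And>l. l \<in> B \<Longrightarrow> y l = 0"
        using y_sum y_nonneg True fin by (simp add: sum_nonneg_eq_0_iff)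
      ultimately have "partial_tensor A i B x y = z"
        using True y_sum by (intro partial_tensor_eqI[OF z_ext]) auto
      with x show ?thesis by blast
    next
      case False
      with b have b_pos: "\<beta> B > 0" by simp
      define x where "x = (\<lambda>j\<in>A. (if j = i then sum z B else z j) / \<beta> B)"
      have xi: "x i = sum z B / \<beta> B"
        using \<open>i \<in> A\<close> by (simp add: x_def)
      have xj: "x j = z j / \<beta> B" if "j \<in> A - {i}" for j
        using that by (simp add: x_def)
      have "(\<Sum>j\<in>A. x j) = x i + (\<Sum>j\<in>A - {i}. x j)"
        using fin \<open>i \<in> A\<close> by (simp add: sum.remove)
      also have "\<dots> = (sum z B + (\<Sum>j\<in>A - {i}. z j)) / \<beta> B"
        by (simp add: xi xj add_divide_distrib flip: sum_divide_distrib)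
      also have "\<dots> = \<alpha> A"
        using z_sum b_pos by (simp add: add.commute)
      finally have "(\<Sum>j\<in>A. x j) = \<alpha> A" .
      moreover have "x j \<ge> \<alpha> {j}" if "j \<in> A" for j
      proof (cases "j = i")
        case True
        then show ?thesis
          using xi b z_inner \<open>\<alpha> {i} = 0\<close> by (simp add: sum_nonneg)
      next
        case False
        then show ?thesis
          using that z_outer[of j] b_pos by (simp add: xj pos_le_divide_eq mult.commute)
      qed
      ultimately have "x \<in> imputations A \<alpha>"
        by (simp add: imputations_def x_def)
      moreover have "partial_tensor A i B x y = z"
        using b_pos y_sum y_prop
        by (intro partial_tensor_eqI[OF z_ext]) (simp_all add: xi xj)
      ultimately show ?thesis by blast
    qed
    with y show "z \<in> (\<lambda>(x, y). partial_tensor A i B x y) ` (imputations A \<alpha> \<times> imputations B \<beta>)"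
      by (auto intro!: image_eqI)
  qed
qed

end
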